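(* Let $S\subseteq\mathbb{N}$. A function $\varphi:\mathbb{N}\to\mathbb{N}$ is a functional promise closure property of $\#\mathsf{FA}$ with regard to $S$ if and only if there is a functional closure property $\psi:\mathbb{N}\to\mathbb{N}$ of $\#\mathsf{FA}$ with $\varphi(n)=\psi(n)$ for all $n\in S$.
   Context: $\mathbb{N}=\{0,1,2,\dots\}$. An NFA is a tuple $M=(Q,\Sigma,\mathrm{wt},\mathrm{in},\mathrm{out})$ with $Q,\Sigma$ finite, $\mathrm{wt}:Q\times\Sigma\times Q\to\mathbb{N}$, $\mathrm{in},\mathrm{out}:Q\to\mathbb{N}$; on input $w=w_1\cdots w_n$ it outputs $\sum_{q_0,\dots,q_n\in Q}\mathrm{in}(q_0)\prod_{i=1}^n\mathrm{wt}(q_{i-1},w_i,q_i)\mathrm{out}(q_n)$. $\#\mathsf{FA}$ is the set of functions $\Sigma^\star\to\mathbb{N}$ (over finite alphabets) computed by NFAs. $\psi:\mathbb{N}\to\mathbb{N}$ is a functional closure property of $\#\mathsf{FA}$ if for every $f\in\#\mathsf{FA}$, $w\mapsto\psi(f(w))$ is in $\#\mathsf{FA}$. $\varphi$ is a functional promise closure property of $\#\mathsf{FA}$ with regard to $S$ if for every $f\in\#\mathsf{FA}$ over an alphabet $\Sigma$ there is $g\in\#\mathsf{FA}$ with $g(w)=\varphi(f(w))$ for every $w\in\Sigma^\star$ with $f(w)\in S$. *)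

theory Defs
  imports Main
begin

record ('q, 'a) nfa =
  states :: "'q set"
  alphabet :: "'a set"
  wt :: "'q \<Rightarrow> 'a \<Rightarrow> 'q \<Rightarrow> nat"
  init :: "'q \<Rightarrow> nat"
  out :: "'q \<Rightarrow> nat"

definition is_nfa :: "('q, 'a) nfa \<Rightarrow> bool" where
  "is_nfa M \<longleftrightarrow> finite (states M) \<and> finite (alphabet M)"

text \<open>The state sequences \<open>q\<^sub>0, \<dots>, q\<^sub>n\<close> are the lists over the state set of length \<open>n + 1\<close>.
  The values of \<open>wt\<close>, \<open>init\<close>, \<open>out\<close> outside the state set and the alphabet are never used
  on words over the alphabet.\<close>

definition nfa_output :: "('q, 'a) nfa \<Rightarrow> 'a list \<Rightarrow> nat" where
  "nfa_output M w =
     (\<Sum>q\<in>{q. set q \<subseteq> states M \<and> length q = length w + 1}.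
        init M (q ! 0) * (\<Prod>i<length w. wt M (q ! i) (w ! i) (q ! (i + 1))) * out M (q ! length w))"

text \<open>\<open>sharpFA \<Sigma>\<close> is the part of the class \<open>#FA\<close> with domain \<open>\<Sigma>\<^sup>*\<close>. A function on \<open>\<Sigma>\<^sup>*\<close>
  is represented by a total function on lists whose values outside \<open>lists \<Sigma>\<close> are irrelevant.
  Taking states in \<open>nat\<close> loses no generality, since the state set is finite and can be renamed.\<close>

definition sharpFA :: "'a set \<Rightarrow> ('a list \<Rightarrow> nat) set" where
  "sharpFA \<Sigma> = {f. \<exists>M :: (nat, 'a) nfa. is_nfa M \<and> alphabet M = \<Sigma> \<and>
                      (\<forall>w\<in>lists \<Sigma>. f w = nfa_output M w)}"

text \<open>A quantifier over all finite alphabets is a quantifier over all finite sets of naturals: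
  every finite alphabet is in bijection with such a set, and quantification over types is not
  available inside a definition.\<close>

definition functional_closure_property :: "(nat \<Rightarrow> nat) \<Rightarrow> bool" where
  "functional_closure_property \<psi> \<longleftrightarrow>
     (\<forall>\<Sigma> :: nat set. finite \<Sigma> \<longrightarrow>
        (\<forall>f \<in> sharpFA \<Sigma>. (\<lambda>w. \<psi> (f w)) \<in> sharpFA \<Sigma>))"

definition functional_promise_closure_property :: "nat set \<Rightarrow> (nat \<Rightarrow> nat) \<Rightarrow> bool" where
  "functional_promise_closure_property S \<phi> \<longleftrightarrow>
     (\<forall>\<Sigma> :: nat set. finite \<Sigma> \<longrightarrow>
        (\<forall>f \<in> sharpFA \<Sigma>. \<exists>g \<in> sharpFA \<Sigma>. \<forall>w\<in>lists \<Sigma>. f w \<in> S \<longrightarrow> g w = \<phi> (f w)))"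

end

theory Submission
  imports Defs
begin

text \<open>
  For the nontrivial direction, apply the promise to two functions. The binary value of a word shows
  that \<open>\<phi>\<close> grows at most polynomially on \<open>S\<close>; the length of a unary word shows that \<open>\<phi>\<close> agrees on
  \<open>S\<close> with a sequence \<open>G\<close> given by a linear recurrence with a nonnegative integer matrix. After
  splitting into residue classes modulo a suitable period, \<open>G\<close> either grows exponentially on a
  class, which then contains only finitely many elements of \<open>S\<close>, or is obtained by shifts and
  summations along an acyclic graph. Functional closure properties contain all eventually periodic
  functions and are closed under sums, products, composition and \<open>n \<mapsto> (\<Sum>i<n. \<psi> i)\<close>, so the second
  kind of class contributes a closure property. For summation, the index \<open>i < f w\<close> is viewed as the
  lexicographic rank of a path for \<open>w\<close>; the rank is itself computed by an automaton reading the path.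
\<close>

section \<open>Automata as stable families of functions\<close>

text \<open>Recursion on the word replaces the sum over state sequences, so that later arguments can
  use induction.\<close>

primrec run :: "('q, 'a) nfa \<Rightarrow> 'a list \<Rightarrow> 'q \<Rightarrow> nat" where
  "run M [] q = out M q"
| "run M (a # w) q = (\<Sum>q'\<in>states M. wt M q a q' * run M w q')"

lemma lists_length_Suc:
  "{p. set p \<subseteq> Q \<and> length p = Suc n} = (\<lambda>(q, p). q # p) ` (Q \<times> {p. set p \<subseteq> Q \<and> length p = n})"
  by (auto simp: length_Suc_conv image_iff)

lemma sum_lists_length_Suc:
  "(\<Sum>p\<in>{p. set p \<subseteq> Q \<and> length p = Suc n}. h p) =
   (\<Sum>q\<in>Q. \<Sum>p\<in>{p. set p \<subseteq> Q \<and> length p = n}. h (q # p))"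
proof -
  have "inj_on (\<lambda>(q, p). q # p) (Q \<times> {p. set p \<subseteq> Q \<and> length p = n})"
    by (auto simp: inj_on_def)
  then show ?thesis
    unfolding lists_length_Suc by (simp add: sum.reindex sum.cartesian_product case_prod_unfold)
qed

lemma path_sum_eq_run:
  "(\<Sum>p\<in>{p. set p \<subseteq> states M \<and> length p = Suc (length w)}.
      i (p ! 0) * (\<Prod>k<length w. wt M (p ! k) (w ! k) (p ! Suc k)) * out M (p ! length w)) =
   (\<Sum>q\<in>states M. i q * run M w q)"
proof (induction w arbitrary: i)
  case Nil
  have "{p. set p \<subseteq> states M \<and> p = []} = {[]}" by auto
  then show ?case by (simp add: sum_lists_length_Suc)
next
  case (Cons a w)
  have "(\<Sum>p\<in>{p. set p \<subseteq> states M \<and> length p = Suc (length (a # w))}.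
      i (p ! 0) * (\<Prod>k<length (a # w). wt M (p ! k) ((a # w) ! k) (p ! Suc k)) * out M (p ! length (a # w)))
    = (\<Sum>q\<in>states M. \<Sum>p\<in>{p. set p \<subseteq> states M \<and> length p = Suc (length w)}.
      i q * (wt M q a (p ! 0)) * (\<Prod>k<length w. wt M (p ! k) (w ! k) (p ! Suc k)) * out M (p ! length w))"
    unfolding list.size add_Suc_right add_0_right
    by (subst sum_lists_length_Suc) (simp add: prod.lessThan_Suc_shift mult.assoc del: prod.lessThan_Suc)
  \<comment> \<open>For fixed \<open>q\<close> the first transition is absorbed into the initial
    weights: the induction hypothesis is applied with \<open>i q * wt M q a\<close> in place of
    \<open>i\<close>.\<close>
  also have "\<dots> = (\<Sum>q\<in>states M. \<Sum>q'\<in>states M. i q * wt M q a q' * run M w q')"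
    by (rule sum.cong[OF refl]) (rule Cons.IH)
  finally show ?case by (simp add: sum_distrib_left mult.assoc)
qed

lemma nfa_output_eq_run: "nfa_output M w = (\<Sum>q\<in>states M. init M q * run M w q)"
  using path_sum_eq_run[where i = "init M" and M = M and w = w] by (simp add: nfa_output_def)

text \<open>A function is in \<open>#FA\<close> iff it lies in the span of a finite family that is closed, up to taking
  spans, under prepending a letter to the argument.\<close>

definition spanned :: "'a set \<Rightarrow> 'q set \<Rightarrow> ('q \<Rightarrow> 'a list \<Rightarrow> nat) \<Rightarrow> ('a list \<Rightarrow> nat) \<Rightarrow> bool" where
  "spanned \<Sigma> Q X h \<longleftrightarrow> (\<exists>c. \<forall>w\<in>lists \<Sigma>. h w = (\<Sum>q\<in>Q. c q * X q w))"

lemma spannedI: "(\<And>w. w \<in> lists \<Sigma> \<Longrightarrow> h w = (\<Sum>q\<in>Q. c q * X q w)) \<Longrightarrow> spanned \<Sigma> Q X h"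
  unfolding spanned_def by blast

lemma spanned_cong:
  "spanned \<Sigma> Q X h \<Longrightarrow> (\<And>w. w \<in> lists \<Sigma> \<Longrightarrow> h' w = h w) \<Longrightarrow> spanned \<Sigma> Q X h'"
  unfolding spanned_def by auto

lemma spanned_zero: "spanned \<Sigma> Q X (\<lambda>w. 0)"
  by (rule spannedI[where c = "\<lambda>_. 0"]) simp

lemma spanned_member: "finite Q \<Longrightarrow> q \<in> Q \<Longrightarrow> spanned \<Sigma> Q X (X q)"
  by (rule spannedI[where c = "\<lambda>p. of_bool (p = q)"]) (simp add: of_bool_def if_distrib[of "\<lambda>x. x * _"] cong: if_cong)

lemma spanned_add:
  assumes "spanned \<Sigma> Q X g" "spanned \<Sigma> Q X h"
  shows "spanned \<Sigma> Q X (\<lambda>w. g w + h w)"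
proof -
  from assms obtain c d where
    "\<forall>w\<in>lists \<Sigma>. g w = (\<Sum>q\<in>Q. c q * X q w)" "\<forall>w\<in>lists \<Sigma>. h w = (\<Sum>q\<in>Q. d q * X q w)"
    unfolding spanned_def by blast
  then show ?thesis
    by (intro spannedI[where c = "\<lambda>q. c q + d q"]) (simp add: sum.distrib algebra_simps)
qed

lemma spanned_scale:
  assumes "spanned \<Sigma> Q X g"
  shows "spanned \<Sigma> Q X (\<lambda>w. k * g w)"
proof -
  from assms obtain c where "\<forall>w\<in>lists \<Sigma>. g w = (\<Sum>q\<in>Q. c q * X q w)"
    unfolding spanned_def by blast
  then show ?thesis
    by (intro spannedI[where c = "\<lambda>q. k * c q"]) (simp add: sum_distrib_left algebra_simps)
qed

lemma spanned_sum:
  "(\<And>i. i \<in> I \<Longrightarrow> spanned \<Sigma> Q X (g i)) \<Longrightarrow> spanned \<Sigma> Q X (\<lambda>w. \<Sum>i\<in>I. g i w)"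
  by (induction I rule: infinite_finite_induct) (auto intro: spanned_zero spanned_add)

lemma spanned_trans:
  assumes "spanned \<Sigma> Q X h" "\<And>q. q \<in> Q \<Longrightarrow> spanned \<Sigma> R Y (X q)"
  shows "spanned \<Sigma> R Y h"
proof -
  from assms(1) obtain c where "\<forall>w\<in>lists \<Sigma>. h w = (\<Sum>q\<in>Q. c q * X q w)"
    unfolding spanned_def by blast
  then show ?thesis
    by (intro spanned_cong[OF spanned_sum[OF spanned_scale[OF assms(2)]]]) auto
qed

definition stable_family :: "'a set \<Rightarrow> 'q set \<Rightarrow> ('q \<Rightarrow> 'a list \<Rightarrow> nat) \<Rightarrow> bool" where
  "stable_family \<Sigma> Q X \<longleftrightarrow> finite \<Sigma> \<and> finite Q \<and> (\<forall>q\<in>Q. \<forall>a\<in>\<Sigma>. spanned \<Sigma> Q X (\<lambda>w. X q (a # w)))"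

lemma stableI:
  "finite \<Sigma> \<Longrightarrow> finite Q \<Longrightarrow> (\<And>q a. q \<in> Q \<Longrightarrow> a \<in> \<Sigma> \<Longrightarrow> spanned \<Sigma> Q X (\<lambda>w. X q (a # w))) \<Longrightarrow>
   stable_family \<Sigma> Q X"
  unfolding stable_family_def by blast

lemma stableD:
  assumes "stable_family \<Sigma> Q X"
  shows "finite \<Sigma>" "finite Q" "q \<in> Q \<Longrightarrow> a \<in> \<Sigma> \<Longrightarrow> spanned \<Sigma> Q X (\<lambda>w. X q (a # w))"
  using assms unfolding stable_family_def by blast+

lemma stable_coeffs:
  assumes "stable_family \<Sigma> Q X"
  shows "\<exists>c. \<forall>q\<in>Q. \<forall>a\<in>\<Sigma>. \<forall>w\<in>lists \<Sigma>. X q (a # w) = (\<Sum>p\<in>Q. c q a p * X p w)"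
proof -
  have "\<forall>q a. \<exists>c. q \<in> Q \<longrightarrow> a \<in> \<Sigma> \<longrightarrow> (\<forall>w\<in>lists \<Sigma>. X q (a # w) = (\<Sum>p\<in>Q. c p * X p w))"
    using stableD(3)[OF assms] unfolding spanned_def by blast
  then show ?thesis by metis
qed

text \<open>The family is itself an automaton: indices are states, the coefficients for prepending a
  letter are transition weights, the values at \<open>[]\<close> are final weights, and the
  coefficients of \<open>f\<close> are initial weights.\<close>

lemma sharpFA_span:
  assumes st: "stable_family \<Sigma> Q X" and "spanned \<Sigma> Q X f"
  shows "f \<in> sharpFA \<Sigma>"
proof -
  obtain c where c: "\<forall>q\<in>Q. \<forall>a\<in>\<Sigma>. \<forall>w\<in>lists \<Sigma>. X q (a # w) = (\<Sum>p\<in>Q. c q a p * X p w)"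
    using stable_coeffs[OF st] by blast
  from assms(2) obtain i where i: "\<forall>w\<in>lists \<Sigma>. f w = (\<Sum>q\<in>Q. i q * X q w)"
    unfolding spanned_def by blast
  obtain e :: "'b \<Rightarrow> nat" where e: "inj_on e Q"
    using finite_imp_inj_to_nat_seg[OF stableD(2)[OF st]] by blast
  define d where "d = inv_into Q e"
  have d: "d (e q) = q" if "q \<in> Q" for q using e that by (simp add: d_def)
  define M :: "(nat, 'a) nfa" where "M = \<lparr>states = e ` Q, alphabet = \<Sigma>,
    wt = (\<lambda>p a p'. c (d p) a (d p')), init = (\<lambda>p. i (d p)), out = (\<lambda>p. X (d p) [])\<rparr>"
  have run_e: "run M w (e q) = X q w" if "w \<in> lists \<Sigma>" "q \<in> Q" for w q
    using that
  proof (induction w arbitrary: q)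
    case Nil
    then show ?case by (simp add: M_def d)
  next
    case (Cons a w)
    have "run M (a # w) (e q) = (\<Sum>p\<in>Q. wt M (e q) a (e p) * run M w (e p))"
      using e by (simp add: M_def sum.reindex)
    also have "\<dots> = (\<Sum>p\<in>Q. c q a p * X p w)"
      using Cons by (intro sum.cong) (auto simp: M_def d)
    finally show ?case using c Cons.prems Cons.hyps by simp
  qed
  have "f w = nfa_output M w" if "w \<in> lists \<Sigma>" for w
  proof -
    have "nfa_output M w = (\<Sum>q\<in>Q. init M (e q) * run M w (e q))"
      unfolding nfa_output_eq_run using e by (simp add: M_def sum.reindex)
    also have "\<dots> = (\<Sum>q\<in>Q. i q * X q w)"
      using that by (intro sum.cong) (auto simp: run_e, simp add: M_def d)
    finally show ?thesis using i that by simp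
  qed
  moreover have "is_nfa M" "alphabet M = \<Sigma>"
    using stableD(1,2)[OF st] by (auto simp: is_nfa_def M_def)
  ultimately show ?thesis unfolding sharpFA_def by blast
qed

lemma sharpFA_member: "stable_family \<Sigma> Q X \<Longrightarrow> q \<in> Q \<Longrightarrow> X q \<in> sharpFA \<Sigma>"
  by (rule sharpFA_span[OF _ spanned_member]) (auto dest: stableD)

lemma sharpFA_cong:
  "f \<in> sharpFA \<Sigma> \<Longrightarrow> (\<And>w. w \<in> lists \<Sigma> \<Longrightarrow> g w = f w) \<Longrightarrow> g \<in> sharpFA \<Sigma>"
  unfolding sharpFA_def by fastforce

lemma sharpFA_finite: "f \<in> sharpFA \<Sigma> \<Longrightarrow> finite \<Sigma>"
  unfolding sharpFA_def is_nfa_def by auto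

lemma sharpFA_stable:
  assumes "f \<in> sharpFA \<Sigma>"
  obtains Q :: "nat option set" and X q0 where "stable_family \<Sigma> Q X" "q0 \<in> Q" "X q0 = f"
proof -
  from assms obtain M :: "(nat, 'a) nfa" where M: "is_nfa M" "alphabet M = \<Sigma>"
    "\<And>w. w \<in> lists \<Sigma> \<Longrightarrow> f w = nfa_output M w"
    unfolding sharpFA_def by blast
  \<comment> \<open>The extra index \<open>None\<close> carries \<open>f\<close> itself, so that
    \<open>f\<close> is a member of the family and not only a combination of members.\<close>
  let ?Q = "insert None (Some ` states M)"
  define X where "X = case_option f (\<lambda>q w. run M w q)"
  have fin: "finite ?Q" "finite \<Sigma>" using M by (auto simp: is_nfa_def)
  have run: "spanned \<Sigma> ?Q X (\<lambda>w. run M w q)" if "q \<in> states M" for q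
    using spanned_member[of ?Q "Some q" \<Sigma> X] fin that by (simp add: X_def)
  have step: "spanned \<Sigma> ?Q X (\<lambda>w. run M (a # w) q)" for a q
    by (auto intro!: spanned_sum spanned_scale run)
  have "stable_family \<Sigma> ?Q X"
  proof (rule stableI)
    fix q a assume q: "q \<in> ?Q" and a: "a \<in> \<Sigma>"
    show "spanned \<Sigma> ?Q X (\<lambda>w. X q (a # w))"
    proof (cases q)
      case None
      have "spanned \<Sigma> ?Q X (\<lambda>w. \<Sum>q\<in>states M. init M q * run M (a # w) q)"
        by (intro spanned_sum spanned_scale step)
      then show ?thesis
        by (rule spanned_cong) (use None M a in \<open>simp add: X_def nfa_output_eq_run\<close>)
    next
      case (Some p)
      then show ?thesis using step[of a p] by (simp add: X_def)
    qed
  qed (use fin in auto)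
  then show ?thesis using that[of ?Q X None] by (simp add: X_def)
qed

section \<open>Closure under elementary operations\<close>

lemma sharpFA_const: "finite \<Sigma> \<Longrightarrow> (\<lambda>w. k) \<in> sharpFA \<Sigma>"
proof -
  assume "finite \<Sigma>"
  then have "stable_family \<Sigma> {()} (\<lambda>_ _. 1)"
    by (intro stableI) (auto intro!: spannedI[where c = "\<lambda>_. 1"])
  then show ?thesis by (rule sharpFA_span) (auto intro!: spannedI[where c = "\<lambda>_. k"])
qed

lemma sharpFA_add:
  assumes "f \<in> sharpFA \<Sigma>" "g \<in> sharpFA \<Sigma>"
  shows "(\<lambda>w. f w + g w) \<in> sharpFA \<Sigma>"
proof -
  obtain Q :: "nat option set" and X p where X: "stable_family \<Sigma> Q X" "p \<in> Q" "X p = f"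
    by (rule sharpFA_stable[OF assms(1)])
  obtain R :: "nat option set" and Y q where Y: "stable_family \<Sigma> R Y" "q \<in> R" "Y q = g"
    by (rule sharpFA_stable[OF assms(2)])
  let ?P = "Q <+> R" and ?Z = "case_sum X Y"
  have fin: "finite ?P" using stableD[OF X(1)] stableD[OF Y(1)] by simp
  have l: "spanned \<Sigma> ?P ?Z (X s)" if "s \<in> Q" for s
    using spanned_member[OF fin InlI[OF that], of \<Sigma> ?Z] by simp
  have r: "spanned \<Sigma> ?P ?Z (Y s)" if "s \<in> R" for s
    using spanned_member[OF fin InrI[OF that], of \<Sigma> ?Z] by simp
  have "stable_family \<Sigma> ?P ?Z"
  proof (rule stableI)
    fix z a assume "z \<in> ?P" "a \<in> \<Sigma>"
    then show "spanned \<Sigma> ?P ?Z (\<lambda>w. ?Z z (a # w))"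
      by (cases z) (auto intro: spanned_trans[OF stableD(3)[OF X(1)] l] spanned_trans[OF stableD(3)[OF Y(1)] r])
  qed (use fin stableD[OF X(1)] in auto)
  then show ?thesis
    using l[OF X(2)] r[OF Y(2)] X(3) Y(3) by (intro sharpFA_span spanned_add) auto
qed

text \<open>Product automaton: the pairwise products of two stable families form a stable family,
  because a product of linear combinations is a combination of products.\<close>

lemma sharpFA_mult:
  assumes "f \<in> sharpFA \<Sigma>" "g \<in> sharpFA \<Sigma>"
  shows "(\<lambda>w. f w * g w) \<in> sharpFA \<Sigma>"
proof -
  obtain Q :: "nat option set" and X p where X: "stable_family \<Sigma> Q X" "p \<in> Q" "X p = f"
    by (rule sharpFA_stable[OF assms(1)])
  obtain R :: "nat option set" and Y q where Y: "stable_family \<Sigma> R Y" "q \<in> R" "Y q = g"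
    by (rule sharpFA_stable[OF assms(2)])
  let ?P = "Q \<times> R" and ?Z = "\<lambda>(s, t) w. X s w * Y t w"
  obtain c where c: "\<forall>q\<in>Q. \<forall>a\<in>\<Sigma>. \<forall>w\<in>lists \<Sigma>. X q (a # w) = (\<Sum>p\<in>Q. c q a p * X p w)"
    using stable_coeffs[OF X(1)] by blast
  obtain d where d: "\<forall>q\<in>R. \<forall>a\<in>\<Sigma>. \<forall>w\<in>lists \<Sigma>. Y q (a # w) = (\<Sum>p\<in>R. d q a p * Y p w)"
    using stable_coeffs[OF Y(1)] by blast
  have "stable_family \<Sigma> ?P ?Z"
  proof (rule stableI)
    fix z a assume z: "z \<in> ?P" and a: "a \<in> \<Sigma>"
    show "spanned \<Sigma> ?P ?Z (\<lambda>w. ?Z z (a # w))"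
    proof (rule spannedI)
      fix w assume w: "w \<in> lists \<Sigma>"
      have "fst z \<in> Q" "snd z \<in> R" using z by auto
      then have "X (fst z) (a # w) = (\<Sum>s\<in>Q. c (fst z) a s * X s w)"
        "Y (snd z) (a # w) = (\<Sum>t\<in>R. d (snd z) a t * Y t w)"
        using c d a w by blast+
      then have "?Z z (a # w) = (\<Sum>s\<in>Q. c (fst z) a s * X s w) * (\<Sum>t\<in>R. d (snd z) a t * Y t w)"
        by (simp add: case_prod_unfold)
      also have "\<dots> = (\<Sum>(s, t)\<in>?P. (c (fst z) a s * X s w) * (d (snd z) a t * Y t w))"
        by (simp add: sum_product sum.cartesian_product)
      finally show "?Z z (a # w) = (\<Sum>p\<in>?P. (c (fst z) a (fst p) * d (snd z) a (snd p)) * ?Z p w)"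
        by (simp add: case_prod_unfold ac_simps)
    qed
  qed (use stableD[OF X(1)] stableD[OF Y(1)] in auto)
  from sharpFA_member[OF this, of "(p, q)"] show ?thesis using X Y by simp
qed

lemma sharpFA_sum:
  "finite \<Sigma> \<Longrightarrow> (\<And>i. i \<in> I \<Longrightarrow> f i \<in> sharpFA \<Sigma>) \<Longrightarrow> (\<lambda>w. \<Sum>i\<in>I. f i w) \<in> sharpFA \<Sigma>"
  by (induction I rule: infinite_finite_induct) (auto intro: sharpFA_const sharpFA_add)

section \<open>Transport between alphabets\<close>

lemma spanned_map:
  assumes "spanned \<Sigma> Q X f" "h ` \<Gamma> \<subseteq> \<Sigma>"
  shows "spanned \<Gamma> Q (\<lambda>q w. X q (map h w)) (\<lambda>w. f (map h w))"
proof -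
  have "map h w \<in> lists \<Sigma>" if "w \<in> lists \<Gamma>" for w using assms(2) that by (induction w) auto
  then show ?thesis using assms(1) unfolding spanned_def by blast
qed

lemma sharpFA_map:
  assumes "f \<in> sharpFA \<Sigma>" "h ` \<Gamma> \<subseteq> \<Sigma>" "finite \<Gamma>"
  shows "(\<lambda>w. f (map h w)) \<in> sharpFA \<Gamma>"
proof -
  obtain Q :: "nat option set" and X p where X: "stable_family \<Sigma> Q X" "p \<in> Q" "X p = f"
    by (rule sharpFA_stable[OF assms(1)])
  have "stable_family \<Gamma> Q (\<lambda>q w. X q (map h w))"
  proof (rule stableI)
    fix q a assume "q \<in> Q" "a \<in> \<Gamma>"
    then have "spanned \<Sigma> Q X (\<lambda>w. X q (h a # w))"
      using stableD(3)[OF X(1)] assms(2) by blast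
    from spanned_map[OF this assms(2)] show "spanned \<Gamma> Q (\<lambda>q w. X q (map h w)) (\<lambda>w. X q (map h (a # w)))"
      by simp
  qed (use stableD[OF X(1)] assms(3) in auto)
  from sharpFA_member[OF this X(2)] show ?thesis using X(3) by simp
qed

text \<open>The definition speaks of alphabets of naturals only. Encoding letters injectively and
  decoding them again carries the property to every type, in particular to the product alphabets
  used for summation.\<close>

lemma functional_closure_propertyD:
  fixes \<Sigma> :: "'a set"
  assumes "functional_closure_property \<psi>" "f \<in> sharpFA \<Sigma>"
  shows "(\<lambda>w. \<psi> (f w)) \<in> sharpFA \<Sigma>"
proof -
  note fin = sharpFA_finite[OF assms(2)]
  obtain e :: "'a \<Rightarrow> nat" where e: "inj_on e \<Sigma>"
    using finite_imp_inj_to_nat_seg[OF fin] by blast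
  define d where "d = inv_into \<Sigma> e"
  have d: "map d (map e w) = w" if "w \<in> lists \<Sigma>" for w
    using e that by (induction w) (auto simp: d_def)
  have "(\<lambda>w. f (map d w)) \<in> sharpFA (e ` \<Sigma>)"
    using assms(2) by (rule sharpFA_map) (use e fin in \<open>auto simp: d_def\<close>)
  then have "(\<lambda>w. \<psi> (f (map d w))) \<in> sharpFA (e ` \<Sigma>)"
    using assms(1) fin unfolding functional_closure_property_def by auto
  then have "(\<lambda>w. \<psi> (f (map d (map e w)))) \<in> sharpFA \<Sigma>"
    by (rule sharpFA_map) (use fin in auto)
  then show ?thesis by (rule sharpFA_cong) (simp only: d)
qed

lemma functional_closure_propertyI:
  "(\<And>(\<Sigma> :: nat set) f. f \<in> sharpFA \<Sigma> \<Longrightarrow> (\<lambda>w. \<psi> (f w)) \<in> sharpFA \<Sigma>) \<Longrightarrow> functional_closure_property \<psi>"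
  unfolding functional_closure_property_def by blast

section \<open>Algebra of functional closure properties\<close>

lemma fcp_const: "functional_closure_property (\<lambda>n. k)"
  by (auto intro!: functional_closure_propertyI sharpFA_const dest: sharpFA_finite)

lemma fcp_add:
  "functional_closure_property \<psi> \<Longrightarrow> functional_closure_property \<theta> \<Longrightarrow>
   functional_closure_property (\<lambda>n. \<psi> n + \<theta> n)"
  by (rule functional_closure_propertyI) (rule sharpFA_add; erule (1) functional_closure_propertyD)

lemma fcp_mult:
  "functional_closure_property \<psi> \<Longrightarrow> functional_closure_property \<theta> \<Longrightarrow>
   functional_closure_property (\<lambda>n. \<psi> n * \<theta> n)"
  by (rule functional_closure_propertyI) (rule sharpFA_mult; erule (1) functional_closure_propertyD)

lemma fcp_comp:
  "functional_closure_property \<psi> \<Longrightarrow> functional_closure_property \<theta> \<Longrightarrow>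
   functional_closure_property (\<lambda>n. \<psi> (\<theta> n))"
  by (rule functional_closure_propertyI) (rule functional_closure_propertyD[where \<psi> = \<psi>]; assumption?; erule (1) functional_closure_propertyD)

lemma fcp_sum:
  "(\<And>i. i \<in> I \<Longrightarrow> functional_closure_property (f i)) \<Longrightarrow> functional_closure_property (\<lambda>n. \<Sum>i\<in>I. f i n)"
  by (induction I rule: infinite_finite_induct) (auto intro: fcp_const fcp_add)

text \<open>The relation \<open>eq\<close> below has finitely many classes, respects addition and
  multiplication by a fixed number, and \<open>h\<close> is constant on its classes. So
  \<open>h\<close> of a weighted sum depends on the weights only up to \<open>eq\<close>, and
  finitely many weight vectors suffice.\<close>

lemma fcp_eventually_periodic:
  assumes P: "P > 0" and per: "\<And>n. n \<ge> N \<Longrightarrow> h (n + P) = h n"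
  shows "functional_closure_property h"
proof (rule functional_closure_propertyI)
  fix \<Sigma> :: "nat set" and f assume "f \<in> sharpFA \<Sigma>"
  then obtain Q :: "nat option set" and X q0 where X: "stable_family \<Sigma> Q X" "q0 \<in> Q" "X q0 = f"
    by (rule sharpFA_stable)
  obtain c where c: "\<forall>q\<in>Q. \<forall>a\<in>\<Sigma>. \<forall>w\<in>lists \<Sigma>. X q (a # w) = (\<Sum>p\<in>Q. c q a p * X p w)"
    using stable_coeffs[OF X(1)] by blast
  \<comment> \<open>Picks the representative below \<open>N + P\<close> of each class of
    \<open>eq\<close>.\<close>
  define \<rho> where "\<rho> n = (if n < N then n else N + (n - N) mod P)" for n
  define eq where "eq x y \<longleftrightarrow> x = y \<or> N \<le> x \<and> N \<le> y \<and> x mod P = y mod P" for x y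
  have \<rho>_less: "\<rho> n < N + P" for n using P by (simp add: \<rho>_def)
  have eq_\<rho>: "eq (\<rho> n) n" for n
    by (auto simp: \<rho>_def eq_def mod_add_right_eq)
  have h_mult: "h (n + k * P) = h n" if "n \<ge> N" for n k
  proof (induction k)
    case (Suc k)
    then show ?case using per[of "n + k * P"] that by (simp add: algebra_simps)
  qed simp
  have eq_h_le: "h x = h y" if "eq x y" "x \<le> y" for x y
  proof (cases "x = y")
    case False
    then have xy: "N \<le> x" "x mod P = y mod P" using that by (auto simp: eq_def)
    obtain k where "y = x + P * k"
      by (rule mod_eq_nat2E[OF xy(2) \<open>x \<le> y\<close>])
    then show ?thesis using h_mult[of x k] xy by (simp add: mult.commute)
  qed simp
  have eq_h: "h x = h y" if "eq x y" for x y
  proof (cases "x \<le> y")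
    case False
    have "eq y x" using that unfolding eq_def by metis
    then show ?thesis using eq_h_le[of y x] False by simp
  qed (rule eq_h_le[OF that])
  have eq_add: "eq (x + y) (x' + y')" if "eq x x'" "eq y y'" for x x' y y'
    using that mod_add_cong[of x P x' y y'] by (auto simp: eq_def)
  \<comment> \<open>For \<open>k > 0\<close> multiplication keeps numbers at or above the threshold
    \<open>N\<close>; for \<open>k = 0\<close> both products are 0.\<close>
  have eq_mult: "eq (x * k) (x' * k)" if "eq x x'" for x x' k
  proof (cases "k = 0 \<or> x = x'")
    case False
    then have *: "N \<le> x" "N \<le> x'" "x mod P = x' mod P" "1 \<le> k" using that by (auto simp: eq_def)
    have "N * 1 \<le> x * k" "N * 1 \<le> x' * k" using * by (intro mult_le_mono; simp)+
    moreover have "(x * k) mod P = (x' * k) mod P" using *(3) by (rule mod_mult_cong) simp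
    ultimately show ?thesis by (simp add: eq_def)
  qed (auto simp: eq_def)
  have eq_sum: "eq (\<Sum>q\<in>A. \<rho> (y q) * x q) (\<Sum>q\<in>A. y q * x q)" for A :: "nat option set" and x y
    by (induction A rule: infinite_finite_induct) (simp_all add: eq_add eq_mult eq_\<rho>, simp_all add: eq_def)
  define V where "V = {v. \<forall>q. (q \<in> Q \<longrightarrow> v q \<in> {..<N + P}) \<and> (q \<notin> Q \<longrightarrow> v q = 0)}"
  define cap where "cap y q = (if q \<in> Q then \<rho> (y q) else 0)" for y q
  have cap: "cap y \<in> V" for y by (auto simp: V_def cap_def \<rho>_less)
  define Z where "Z v w = h (\<Sum>q\<in>Q. v q * X q w)" for v w
  have Z_cap: "Z (cap y) w = h (\<Sum>q\<in>Q. y q * X q w)" for y w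
    using eq_h[OF eq_sum[where A = Q and y = y and x = "\<lambda>q. X q w"]] by (simp add: Z_def cap_def)
  txt \<open>\<open>V\<close> is the state set of a determinization that stores the vector of weights only up to \<open>eq\<close>.\<close>
  have "finite V" unfolding V_def
    by (rule finite_set_of_finite_funs) (use stableD[OF X(1)] in auto)
  have stable: "stable_family \<Sigma> V Z"
  proof (rule stableI)
    fix v a assume "v \<in> V" and a: "a \<in> \<Sigma>"
    \<comment> \<open>Reading \<open>a\<close> turns the weights \<open>v\<close> into
      \<open>y\<close>, and capping \<open>y\<close> does not change the value under
      \<open>h\<close>; so a single member of the family takes over.\<close>
    define y where "y p = (\<Sum>q\<in>Q. v q * c q a p)" for p
    have "Z v (a # w) = Z (cap y) w" if "w \<in> lists \<Sigma>" for w
    proof -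
      have "(\<Sum>q\<in>Q. v q * X q (a # w)) = (\<Sum>q\<in>Q. \<Sum>p\<in>Q. v q * c q a p * X p w)"
        by (rule sum.cong[OF refl]) (use c a that in \<open>simp add: sum_distrib_left mult.assoc del: in_lists_conv_set\<close>)
      also have "\<dots> = (\<Sum>p\<in>Q. y p * X p w)"
        unfolding y_def sum_distrib_right by (rule sum.swap)
      finally show ?thesis by (simp add: Z_cap) (simp add: Z_def)
    qed
    with spanned_member[OF \<open>finite V\<close> cap] show "spanned \<Sigma> V Z (\<lambda>w. Z v (a # w))"
      by (rule spanned_cong)
  qed (use stableD[OF X(1)] \<open>finite V\<close> in auto)
  have "Z (cap (\<lambda>q. of_bool (q = q0))) w = h (f w)" for w
    unfolding Z_cap using X(2,3) stableD(2)[OF X(1)]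
    by (simp add: of_bool_def if_distrib[of "\<lambda>x. x * _"] cong: if_cong)
  then show "(\<lambda>w. h (f w)) \<in> sharpFA \<Sigma>"
    by (intro sharpFA_cong[OF sharpFA_member[OF stable cap]]) (rule sym)
qed

section \<open>Closure under summation\<close>

primrec proj :: "nat \<Rightarrow> 'a list \<Rightarrow> (('a \<times> nat) list \<Rightarrow> nat) \<Rightarrow> nat" where
  "proj J [] G = G []"
| "proj J (a # w) G = (\<Sum>j<J. proj J w (\<lambda>u. G ((a, j) # u)))"

lemma proj_cong:
  assumes "w \<in> lists \<Sigma>" "\<And>u. u \<in> lists (\<Sigma> \<times> {..<J}) \<Longrightarrow> map fst u = w \<Longrightarrow> G u = G' u"
  shows "proj J w G = proj J w G'"
  using assms
proof (induction w arbitrary: G G')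
  case (Cons a w)
  have "proj J w (\<lambda>u. G ((a, j) # u)) = proj J w (\<lambda>u. G' ((a, j) # u))" if "j < J" for j
    by (rule Cons.IH, rule Cons.prems) (use Cons.hyps that in auto)
  then show ?case by simp
qed simp

lemma proj_zero: "proj J w (\<lambda>u. 0) = 0"
  by (induction w) auto

lemma proj_add: "proj J w (\<lambda>u. G u + H u) = proj J w G + proj J w H"
  by (induction w arbitrary: G H) (auto simp: sum.distrib)

lemma proj_scale: "proj J w (\<lambda>u. k * G u) = k * proj J w G"
  by (induction w arbitrary: G) (auto simp: sum_distrib_left)

lemma proj_sum: "proj J w (\<lambda>u. \<Sum>i\<in>I. G i u) = (\<Sum>i\<in>I. proj J w (G i))"
  by (induction I rule: infinite_finite_induct) (auto simp: proj_zero proj_add)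

text \<open>Since \<open>proj J w\<close> is linear, the letter relations of a family for
  \<open>G\<close> survive it; the automaton guesses the label \<open>j < J\<close> of each
  letter.\<close>

lemma sharpFA_proj:
  assumes "G \<in> sharpFA (\<Sigma> \<times> {..<J})" "finite \<Sigma>"
  shows "(\<lambda>w. proj J w G) \<in> sharpFA \<Sigma>"
proof -
  obtain Q :: "nat option set" and X p where X: "stable_family (\<Sigma> \<times> {..<J}) Q X" "p \<in> Q" "X p = G"
    by (rule sharpFA_stable[OF assms(1)])
  let ?Y = "\<lambda>q w. proj J w (X q)"
  have "stable_family \<Sigma> Q ?Y"
  proof (rule stableI)
    fix q a assume q: "q \<in> Q" and a: "a \<in> \<Sigma>"
    have "spanned \<Sigma> Q ?Y (\<lambda>w. proj J w (\<lambda>u. X q ((a, j) # u)))" if "j < J" for j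
    proof -
      have "spanned (\<Sigma> \<times> {..<J}) Q X (\<lambda>w. X q ((a, j) # w))"
        using q a that by (intro stableD(3)[OF X(1)]) auto
      then obtain c where c: "\<forall>u\<in>lists (\<Sigma> \<times> {..<J}). X q ((a, j) # u) = (\<Sum>p\<in>Q. c p * X p u)"
        unfolding spanned_def by blast
      show ?thesis
      proof (rule spannedI)
        fix w assume "w \<in> lists \<Sigma>"
        then have "proj J w (\<lambda>u. X q ((a, j) # u)) = proj J w (\<lambda>u. \<Sum>p\<in>Q. c p * X p u)"
          by (rule proj_cong) (use c in blast)
        then show "proj J w (\<lambda>u. X q ((a, j) # u)) = (\<Sum>p\<in>Q. c p * ?Y p w)"
          by (simp add: proj_sum proj_scale)
      qed
    qed
    then show "spanned \<Sigma> Q ?Y (\<lambda>w. ?Y q (a # w))" by (auto intro!: spanned_sum)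
  qed (use stableD[OF X(1)] assms(2) in auto)
  from sharpFA_member[OF this X(2)] X(3) show ?thesis by simp
qed

section \<open>Paths and their lexicographic ranks\<close>

lemma spanned_list:
  assumes "spanned \<Sigma> Q X h" "finite Q"
  shows "\<exists>xs. set xs \<subseteq> Q \<and> (\<forall>w\<in>lists \<Sigma>. h w = (\<Sum>j<length xs. X (xs ! j) w))"
proof -
  from assms obtain c where c: "\<forall>w\<in>lists \<Sigma>. h w = (\<Sum>q\<in>Q. c q * X q w)"
    unfolding spanned_def by blast
  have "\<exists>xs. set xs \<subseteq> Q \<and> (\<forall>w. (\<Sum>x\<leftarrow>xs. X x w) = (\<Sum>q\<in>Q. c q * X q w))"
    using assms(2)
  proof (induction Q rule: finite_induct)
    case (insert q R)
    then obtain xs where "set xs \<subseteq> R" "\<forall>w. (\<Sum>x\<leftarrow>xs. X x w) = (\<Sum>q\<in>R. c q * X q w)" by blast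
    \<comment> \<open>A natural coefficient becomes a multiplicity, so that every list position is
      one edge of weight one.\<close>
    then show ?case using insert.hyps
      by (intro exI[of _ "replicate (c q) q @ xs"]) (auto simp: sum_list_replicate)
  qed simp
  then obtain xs where "set xs \<subseteq> Q" "\<forall>w. (\<Sum>x\<leftarrow>xs. X x w) = (\<Sum>q\<in>Q. c q * X q w)" by blast
  then show ?thesis using c
    by (intro exI[of _ xs]) (simp add: sum_list_sum_nth atLeast0LessThan)
qed

text \<open>The interval is cut into consecutive blocks of lengths \<open>x j\<close>; the offset
  \<open>c\<close> allows a block to be cut in turn.\<close>

lemma sum_lessThan_sum:
  fixes \<psi> :: "nat \<Rightarrow> nat" and n :: nat
  shows "(\<Sum>i<(\<Sum>j<n. x j). \<psi> (c + i)) = (\<Sum>j<n. \<Sum>i<x j. \<psi> (c + (\<Sum>l<j. x l) + i))"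
proof (induction n)
  case (Suc n)
  have "(\<Sum>i<s + t. \<psi> (c + i)) = (\<Sum>i<s. \<psi> (c + i)) + (\<Sum>i<t. \<psi> (c + s + i))" for s t
    by (induction t) (simp_all add: add.assoc)
  then show ?case by (simp add: Suc)
qed simp

text \<open>A path for \<open>w\<close> is a word over the letters \<open>(a, j)\<close>, where \<open>j\<close> selects an entry of \<open>succ q a\<close>.
  Words that leave the range of some \<open>succ q a\<close> are no paths: \<open>path_end\<close> vanishes on them, and the
  value of \<open>path_rank\<close> is irrelevant.\<close>

context
  fixes X :: "'q \<Rightarrow> 'a list \<Rightarrow> nat" and succ :: "'q \<Rightarrow> 'a \<Rightarrow> 'q list"
begin

text \<open>Counts, with final weights, the lexicographically earlier paths for the same word: at
  each step every lower choice contributes all its continuations.\<close>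

primrec path_rank :: "('a \<times> nat) list \<Rightarrow> 'q \<Rightarrow> nat" where
  "path_rank [] q = 0"
| "path_rank (x # u) q = (if snd x < length (succ q (fst x))
     then (\<Sum>i<snd x. X (succ q (fst x) ! i) (map fst u)) + path_rank u (succ q (fst x) ! snd x) else 0)"

text \<open>A final weight is treated as that many copies of the path, numbered by \<open>k\<close>;
  the value tells whether copy \<open>k\<close> exists.\<close>

primrec path_end :: "nat \<Rightarrow> ('a \<times> nat) list \<Rightarrow> 'q \<Rightarrow> nat" where
  "path_end k [] q = of_bool (k < X q [])"
| "path_end k (x # u) q = (if snd x < length (succ q (fst x))
     then path_end k u (succ q (fst x) ! snd x) else 0)"

context
  fixes \<Sigma> :: "'a set" and Q :: "'q set"
  assumes stable: "stable_family \<Sigma> Q X"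
    and succ_in: "\<And>q a. q \<in> Q \<Longrightarrow> a \<in> \<Sigma> \<Longrightarrow> set (succ q a) \<subseteq> Q"
    and X_Cons: "\<And>q a w. q \<in> Q \<Longrightarrow> a \<in> \<Sigma> \<Longrightarrow> w \<in> lists \<Sigma> \<Longrightarrow>
      X q (a # w) = (\<Sum>j<length (succ q a). X (succ q a ! j) w)"
begin

lemma succ_nth: "q \<in> Q \<Longrightarrow> a \<in> \<Sigma> \<Longrightarrow> j < length (succ q a) \<Longrightarrow> succ q a ! j \<in> Q"
  using succ_in nth_mem by blast

lemma path_end_sharpFA:
  assumes "q \<in> Q"
  shows "(\<lambda>u. path_end k u q) \<in> sharpFA (\<Sigma> \<times> {..<J})"
proof -
  note fin = stableD(1,2)[OF stable]
  have "stable_family (\<Sigma> \<times> {..<J}) Q (\<lambda>q u. path_end k u q)"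
  proof (rule stableI)
    fix q x assume q: "q \<in> Q" and x: "x \<in> \<Sigma> \<times> {..<J}"
    show "spanned (\<Sigma> \<times> {..<J}) Q (\<lambda>q u. path_end k u q) (\<lambda>u. path_end k (x # u) q)"
    proof (cases "snd x < length (succ q (fst x))")
      case True
      then have "succ q (fst x) ! snd x \<in> Q" using succ_nth q x by auto
      from spanned_member[OF fin(2) this, where X = "\<lambda>q u. path_end k u q"] True show ?thesis by simp
    qed (simp add: spanned_zero)
  qed (use fin in auto)
  from sharpFA_member[OF this assms] show ?thesis .
qed

text \<open>The recursion for \<open>path_rank\<close> evaluates \<open>X\<close> on the underlying
  word, so the family must also contain these functions; they are stable by
  \<open>X_Cons\<close>.\<close>

lemma path_rank_sharpFA:
  assumes "q \<in> Q"
  shows "(\<lambda>u. path_rank u q) \<in> sharpFA (\<Sigma> \<times> {..<J})"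
proof -
  note fin = stableD(1,2)[OF stable]
  let ?G = "\<Sigma> \<times> {..<J}" and ?R = "Q <+> Q"
  define Y where "Y = case_sum (\<lambda>q u. path_rank u q) (\<lambda>q u. X q (map fst u))"
  have finR: "finite ?R" using fin by simp
  have l: "spanned ?G ?R Y (\<lambda>u. path_rank u p)" if "p \<in> Q" for p
    using spanned_member[OF finR InlI[OF that], of ?G Y] by (simp add: Y_def)
  have r: "spanned ?G ?R Y (\<lambda>u. X p (map fst u))" if "p \<in> Q" for p
    using spanned_member[OF finR InrI[OF that], of ?G Y] by (simp add: Y_def)
  have "stable_family ?G ?R Y"
  proof (rule stableI)
    fix s x assume s: "s \<in> ?R" and x: "x \<in> ?G"
    then have a: "fst x \<in> \<Sigma>" by auto
    show "spanned ?G ?R Y (\<lambda>u. Y s (x # u))"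
    proof (cases s)
      case (Inl p)
      then have p: "p \<in> Q" using s by auto
      show ?thesis
      proof (cases "snd x < length (succ p (fst x))")
        case True
        have "spanned ?G ?R Y (\<lambda>u. (\<Sum>i<snd x. X (succ p (fst x) ! i) (map fst u)) +
          path_rank u (succ p (fst x) ! snd x))"
          using True by (intro spanned_add spanned_sum l r succ_nth p a) auto
        then show ?thesis using True Inl by (simp add: Y_def)
      qed (simp add: Y_def Inl spanned_zero)
    next
      case (Inr p)
      then have p: "p \<in> Q" using s by auto
      have "spanned ?G ?R Y (\<lambda>u. \<Sum>j<length (succ p (fst x)). X (succ p (fst x) ! j) (map fst u))"
        by (intro spanned_sum r succ_nth p a) auto
      then show ?thesis
      proof (rule spanned_cong)
        fix u assume "u \<in> lists ?G"
        then have "map fst u \<in> lists \<Sigma>" by (induction u) auto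
        then show "Y s (x # u) = (\<Sum>j<length (succ p (fst x)). X (succ p (fst x) ! j) (map fst u))"
          using X_Cons[OF p a] Inr by (simp add: Y_def)
      qed
    qed
  qed (use fin finR in auto)
  from sharpFA_member[OF this InlI[OF assms]] show ?thesis by (simp add: Y_def)
qed

text \<open>Each \<open>i < X q w\<close> belongs to exactly one pair of a path \<open>u\<close> and
  a copy \<open>k\<close>, with \<open>i = path_rank u q + k\<close>. The offset \<open>c\<close> is
  general because passing to a successor skips the continuations of the earlier successors.\<close>

lemma sum_lessThan_eq_proj:
  assumes J: "\<And>q a. q \<in> Q \<Longrightarrow> a \<in> \<Sigma> \<Longrightarrow> length (succ q a) \<le> J"
    and K: "\<And>q. q \<in> Q \<Longrightarrow> X q [] \<le> K"
    and "w \<in> lists \<Sigma>" "q \<in> Q"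
  shows "(\<Sum>i<X q w. \<psi> (c + i)) = proj J w (\<lambda>u. \<Sum>k<K. path_end k u q * \<psi> (c + path_rank u q + k))"
  using assms(3,4)
proof (induction w arbitrary: q c)
  case Nil
  have "(\<Sum>k<K. of_bool (k < X q []) * \<psi> (c + k)) = (\<Sum>k<X q []. \<psi> (c + k))"
    using K[OF Nil] by (intro sum.mono_neutral_cong_right) auto
  then show ?case by simp
next
  case (Cons a w)
  let ?s = "succ q a"
  let ?G = "\<lambda>j u. \<Sum>k<K. path_end k ((a, j) # u) q * \<psi> (c + path_rank ((a, j) # u) q + k)"
  have "(\<Sum>i<X q (a # w). \<psi> (c + i)) =
      (\<Sum>j<length ?s. \<Sum>i<X (?s ! j) w. \<psi> (c + (\<Sum>l<j. X (?s ! l) w) + i))"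
    using X_Cons Cons by (simp add: sum_lessThan_sum del: in_lists_conv_set)
  also have "\<dots> = (\<Sum>j<length ?s. proj J w (?G j))"
  proof (rule sum.cong[OF refl])
    fix j assume j: "j \<in> {..<length ?s}"
    then have "(\<Sum>i<X (?s ! j) w. \<psi> (c + (\<Sum>l<j. X (?s ! l) w) + i)) =
      proj J w (\<lambda>u. \<Sum>k<K. path_end k u (?s ! j) * \<psi> (c + (\<Sum>l<j. X (?s ! l) w) + path_rank u (?s ! j) + k))"
      using Cons succ_nth by simp
    also have "\<dots> = proj J w (?G j)"
      by (rule proj_cong[OF Cons.hyps(2)]) (use j in \<open>auto simp: add.assoc\<close>)
    finally show "(\<Sum>i<X (?s ! j) w. \<psi> (c + (\<Sum>l<j. X (?s ! l) w) + i)) = proj J w (?G j)" .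
  qed
  \<comment> \<open>For \<open>j\<close> beyond the list of successors \<open>path_end\<close>
    vanishes, so one bound \<open>J\<close> serves all states and letters.\<close>
  also have "\<dots> = (\<Sum>j<J. proj J w (?G j))"
    using J[of q a] Cons by (intro sum.mono_neutral_left) (auto simp: proj_zero)
  finally show ?case by simp
qed

end

end

text \<open>By \<open>sum_lessThan_eq_proj\<close> the sum is a projection of a function in which
  \<psi> is applied only to ranks, and these are computed by an automaton on labelled words.\<close>

lemma fcp_sum_lessThan:
  assumes \<psi>: "functional_closure_property \<psi>"
  shows "functional_closure_property (\<lambda>n. \<Sum>i<n. \<psi> i)"
proof (rule functional_closure_propertyI)
  fix \<Sigma> :: "nat set" and f assume "f \<in> sharpFA \<Sigma>"
  then obtain Q :: "nat option set" and X q0 where X: "stable_family \<Sigma> Q X" "q0 \<in> Q" "X q0 = f"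
    by (rule sharpFA_stable)
  note fin = stableD(1,2)[OF X(1)]
  have "\<forall>q a. \<exists>xs. q \<in> Q \<longrightarrow> a \<in> \<Sigma> \<longrightarrow>
      set xs \<subseteq> Q \<and> (\<forall>w\<in>lists \<Sigma>. X q (a # w) = (\<Sum>j<length xs. X (xs ! j) w))"
    using spanned_list[OF stableD(3)[OF X(1)] fin(2)] by blast
  then obtain succ where succ: "\<forall>q a. q \<in> Q \<longrightarrow> a \<in> \<Sigma> \<longrightarrow> set (succ q a) \<subseteq> Q \<and>
      (\<forall>w\<in>lists \<Sigma>. X q (a # w) = (\<Sum>j<length (succ q a). X (succ q a ! j) w))"
    by metis
  define J where "J = Max (insert 0 ((\<lambda>(q, a). length (succ q a)) ` (Q \<times> \<Sigma>)))"
  define K where "K = Max (insert 0 ((\<lambda>q. X q []) ` Q))"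
  have J: "length (succ q a) \<le> J" if "q \<in> Q" "a \<in> \<Sigma>" for q a
    unfolding J_def by (rule Max_ge) (use fin that in auto)
  have K: "X q [] \<le> K" if "q \<in> Q" for q
    unfolding K_def by (rule Max_ge) (use fin that in auto)
  have s: "set (succ q a) \<subseteq> Q" if "q \<in> Q" "a \<in> \<Sigma>" for q a using succ that by blast
  have c: "X q (a # w) = (\<Sum>j<length (succ q a). X (succ q a ! j) w)"
    if "q \<in> Q" "a \<in> \<Sigma>" "w \<in> lists \<Sigma>" for q a w using succ that by blast
  let ?G = "\<lambda>u. \<Sum>k<K. path_end X succ k u q0 * \<psi> (path_rank X succ u q0 + k)"
  have finG: "finite (\<Sigma> \<times> {..<J})" using fin by simp
  have "?G \<in> sharpFA (\<Sigma> \<times> {..<J})"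
    by (intro sharpFA_sum sharpFA_mult sharpFA_add sharpFA_const finG functional_closure_propertyD[OF \<psi>]
      path_end_sharpFA[OF X(1) s c X(2)] path_rank_sharpFA[OF X(1) s c X(2)])
  from sharpFA_proj[OF this fin(1)] have "(\<lambda>w. proj J w ?G) \<in> sharpFA \<Sigma>" .
  then show "(\<lambda>w. \<Sum>i<f w. \<psi> i) \<in> sharpFA \<Sigma>"
  proof (rule sharpFA_cong)
    fix w assume "w \<in> lists \<Sigma>"
    from sum_lessThan_eq_proj[OF X(1) s c J K this X(2), of \<psi> 0]
    show "(\<Sum>i<f w. \<psi> i) = proj J w ?G" using X(3) by simp
  qed
qed

section \<open>Indicators, truncated predecessor and division\<close>

lemma fcp_of_bool_mod: "P > 0 \<Longrightarrow> functional_closure_property (\<lambda>n. of_bool (R (n mod P)))"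
  by (rule fcp_eventually_periodic[where N = 0 and P = P]) auto

lemma fcp_finite_support:
  assumes "finite D"
  shows "functional_closure_property (\<lambda>n. of_bool (n \<in> D) * h n)"
    and "functional_closure_property (\<lambda>n. of_bool (n \<notin> D))"
proof -
  obtain N where N: "\<forall>n\<in>D. n < N"
    using assms finite_nat_set_iff_bounded by blast
  show "functional_closure_property (\<lambda>n. of_bool (n \<in> D) * h n)"
    "functional_closure_property (\<lambda>n. of_bool (n \<notin> D))"
    by (rule fcp_eventually_periodic[where N = N and P = 1]; use N in fastforce)+
qed

lemma fcp_diff_1: "functional_closure_property (\<lambda>n. n - 1)"
proof -
  have "functional_closure_property (\<lambda>n. \<Sum>i<n. of_bool (i \<notin> {0}))"
    by (intro fcp_sum_lessThan fcp_finite_support) simp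
  moreover have "(\<Sum>i<n. of_bool (i \<notin> {0})) = n - 1" for n :: nat
    by (induction n) auto
  ultimately show ?thesis by simp
qed

text \<open>The quotient grows exactly when \<open>i + 1\<close> is a multiple of \<open>P\<close>,
  so it counts such \<open>i < n\<close>.\<close>

lemma fcp_div:
  assumes "P > 0"
  shows "functional_closure_property (\<lambda>n. n div P)"
proof -
  have "functional_closure_property (\<lambda>n. \<Sum>i<n. of_bool (Suc (i mod P) mod P = 0))"
    using assms by (intro fcp_sum_lessThan fcp_of_bool_mod)
  moreover have "(\<Sum>i<n. of_bool (Suc (i mod P) mod P = 0)) = n div P" for n
    by (induction n) (auto simp: div_Suc mod_Suc_eq)
  ultimately show ?thesis by simp
qed

section \<open>Unary automata\<close>

text \<open>The shift \<open>t\<close> lets the lower bound pass from a vertex to its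
  predecessors.\<close>

definition exponential :: "(nat \<Rightarrow> nat) \<Rightarrow> bool" where
  "exponential h \<longleftrightarrow> (\<exists>t. \<forall>m. 2 ^ m \<le> h (m + t))"

section \<open>Walk counts in a finite weighted graph\<close>

context
  fixes Q :: "'q set" and A :: "'q \<Rightarrow> 'q \<Rightarrow> nat"
  assumes finite_Q: "finite Q"
begin

primrec matpow :: "nat \<Rightarrow> 'q \<Rightarrow> 'q \<Rightarrow> nat" where
  "matpow 0 p q = of_bool (p = q)"
| "matpow (Suc k) p q = (\<Sum>s\<in>Q. A p s * matpow k s q)"

lemma matpow_add:
  assumes "p \<in> Q"
  shows "matpow (j + k) p q = (\<Sum>s\<in>Q. matpow j p s * matpow k s q)"
  using assms
proof (induction j arbitrary: p)
  case 0
  then show ?case using finite_Q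
    by (simp add: of_bool_def if_distrib[of "\<lambda>x. x * _"] cong: if_cong)
next
  case (Suc j)
  have "matpow (Suc j + k) p q = (\<Sum>r\<in>Q. \<Sum>s\<in>Q. A p r * matpow j r s * matpow k s q)"
    using Suc.IH by (simp add: sum_distrib_left mult.assoc)
  also have "\<dots> = (\<Sum>s\<in>Q. matpow (Suc j) p s * matpow k s q)"
    by (subst sum.swap) (simp add: sum_distrib_right)
  finally show ?case .
qed

lemma matpow_add_ge:
  assumes "p \<in> Q" "s \<in> Q"
  shows "matpow j p s * matpow k s q \<le> matpow (j + k) p q"
  unfolding matpow_add[OF assms(1)]
  by (rule member_le_sum[where f = "\<lambda>s. matpow j p s * matpow k s q"]) (use finite_Q assms in auto)

text \<open>One closed walk can be fixed for the later rounds while the choice in the first round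
  stays free.\<close>

lemma matpow_diag_mono:
  assumes "q \<in> Q" "matpow k q q > 0"
  shows "matpow k q q \<le> matpow (k * Suc j) q q"
proof (induction j)
  case (Suc j)
  have "matpow k q q * 1 \<le> matpow k q q * matpow (k * Suc j) q q"
    using Suc assms(2) by (intro mult_le_mono) auto
  also have "\<dots> \<le> matpow (k + k * Suc j) q q"
    by (rule matpow_add_ge) (use assms in auto)
  finally show ?case by simp
qed simp

text \<open>For one vertex take a length with diagonal entry at least 2, else a positive length with
  entry 1, else length 1. By \<open>matpow_diag_mono\<close> the property passes to multiples, so
  the product of these lengths works for all vertices.\<close>

lemma good_period:
  "\<exists>P>0. \<forall>q\<in>Q. matpow P q q \<ge> 2 \<or>
     (\<forall>k. matpow k q q \<le> 1) \<and> (matpow P q q = 1 \<or> (\<forall>k>0. matpow k q q = 0))"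
proof -
  let ?good = "\<lambda>k q. matpow k q q \<ge> 2 \<or>
     (\<forall>k. matpow k q q \<le> 1) \<and> (matpow k q q = 1 \<or> (\<forall>k>0. matpow k q q = 0))"
  have "\<exists>k>0. ?good k q" for q
  proof (cases "\<exists>k. matpow k q q \<ge> 2")
    case True
    then obtain k where k: "matpow k q q \<ge> 2" by blast
    then have "k > 0" by (intro gr0I) simp
    with k show ?thesis by (intro exI[of _ k] conjI disjI1)
  next
    case False
    have le: "\<forall>k. matpow k q q \<le> 1"
    proof
      fix k
      have "\<not> matpow k q q \<ge> 2" using False by blast
      then show "matpow k q q \<le> 1" by linarith
    qed
    show ?thesis
    proof (cases "\<exists>k>0. matpow k q q \<noteq> 0")
      case True
      then obtain k where k: "k > 0" "matpow k q q \<noteq> 0" by blast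
      then have "matpow k q q = 1" using le[rule_format, of k] by linarith
      then show ?thesis by (intro exI[of _ k] conjI disjI2 disjI1 k le)
    next
      case False
      then have "\<forall>k>0. matpow k q q = 0" by blast
      then show ?thesis by (intro exI[of _ 1] conjI disjI2 le zero_less_one)
    qed
  qed
  then have "\<exists>k. \<forall>q. k q > 0 \<and> ?good (k q) q" by (intro choice allI)
  then obtain k where k: "\<And>q. k q > 0" "\<And>q. ?good (k q) q" by blast
  define P where "P = (\<Prod>q\<in>Q. k q)"
  have "P > 0" using k(1) by (simp add: P_def prod_pos)
  moreover have "?good P q" if q: "q \<in> Q" for q
  proof -
    have "k q dvd P" unfolding P_def using finite_Q q by auto
    then obtain i where "P = k q * i" by auto
    with \<open>P > 0\<close> obtain j where P: "P = k q * Suc j" by (cases i) auto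
    have mono: "matpow (k q) q q \<le> matpow P q q" if "matpow (k q) q q > 0"
      unfolding P by (rule matpow_diag_mono[OF q that])
    show ?thesis
    proof (cases "matpow (k q) q q \<ge> 2")
      case True
      then show ?thesis using mono by linarith
    next
      case False
      then have le: "\<forall>i. matpow i q q \<le> 1"
        and "matpow (k q) q q = 1 \<or> (\<forall>i>0. matpow i q q = 0)" using k(2)[of q] by blast+
      moreover have "matpow P q q = 1" if "matpow (k q) q q = 1"
        using mono le[rule_format, of P] that by linarith
      ultimately show ?thesis by blast
    qed
  qed
  ultimately show ?thesis by blast
qed

section \<open>Linear recurrences along residue classes\<close>

context
  fixes x :: "'q \<Rightarrow> nat \<Rightarrow> nat"
  assumes x_Suc: "\<And>q n. q \<in> Q \<Longrightarrow> x q (Suc n) = (\<Sum>p\<in>Q. A q p * x p n)"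
begin

lemma x_matpow: "q \<in> Q \<Longrightarrow> x q (k + n) = (\<Sum>p\<in>Q. matpow k q p * x p n)"
proof (induction k arbitrary: q)
  case 0
  then show ?case using finite_Q
    by (simp add: of_bool_def if_distrib[of "\<lambda>x. x * _"] cong: if_cong)
next
  case (Suc k)
  have "x q (Suc k + n) = (\<Sum>r\<in>Q. \<Sum>p\<in>Q. A q r * matpow k r p * x p n)"
    using Suc by (simp add: x_Suc sum_distrib_left mult.assoc)
  also have "\<dots> = (\<Sum>p\<in>Q. matpow (Suc k) q p * x p n)"
    by (subst sum.swap) (simp add: sum_distrib_right)
  finally show ?case .
qed

text \<open>In steps of length \<open>P\<close>, a vertex that is ever nonzero and has diagonal
  weight at least 2 is exponential, and so is every vertex that reaches an exponential one. The
  other nonzero vertices have diagonal 0 or 1 and lie on no further cycles; working back from the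
  sinks, diagonal 0 is a shift and diagonal 1 a summation of closure properties.\<close>

lemma exponential_or_fcp:
  assumes P: "\<And>q. q \<in> Q \<Longrightarrow> matpow P q q \<ge> 2 \<or>
     (\<forall>k. matpow k q q \<le> 1) \<and> (matpow P q q = 1 \<or> (\<forall>k>0. matpow k q q = 0))"
    and "P > 0" "q \<in> Q"
  shows "exponential (\<lambda>m. x q (r + P * m)) \<or> functional_closure_property (\<lambda>m. x q (r + P * m))"
proof -
  define y where "y q m = x q (r + P * m)" for q m
  define B where "B = matpow P"
  have y_Suc: "y q (Suc m) = (\<Sum>p\<in>Q. B q p * y p m)" if "q \<in> Q" for q m
    using x_matpow[OF that, of P "r + P * m"] by (simp add: y_def B_def add.left_commute)
  have y_ge: "B q p * y p m \<le> y q (Suc m)" if "q \<in> Q" "p \<in> Q" for p q m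
    unfolding y_Suc[OF that(1)]
    by (rule member_le_sum[where f = "\<lambda>p. B q p * y p m"]) (use finite_Q that in auto)
  have exp_step: "exponential (y q)" if "q \<in> Q" "p \<in> Q" "B q p > 0" "exponential (y p)" for p q
  proof -
    from that(4) obtain t where t: "\<And>m. 2 ^ m \<le> y p (m + t)"
      unfolding exponential_def by blast
    have "2 ^ m \<le> y q (m + Suc t)" for m
    proof -
      have "1 * 2 ^ m \<le> B q p * y p (m + t)" using t[of m] that(3) by (intro mult_le_mono) auto
      also have "\<dots> \<le> y q (m + Suc t)" using y_ge[OF that(1,2)] by simp
      finally show ?thesis by simp
    qed
    then show ?thesis unfolding exponential_def by blast
  qed
  have exp_loop: "exponential (y q)" if "q \<in> Q" "B q q \<ge> 2" "y q t > 0" for q t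
  proof -
    have "2 ^ m \<le> y q (m + t)" for m
    proof (induction m)
      case (Suc m)
      have "2 * 2 ^ m \<le> B q q * y q (m + t)" using Suc that(2) by (intro mult_le_mono) auto
      also have "\<dots> \<le> y q (Suc m + t)" using y_ge[OF that(1,1)] by simp
      finally show ?case by simp
    qed (use that in simp)
    then show ?thesis unfolding exponential_def by blast
  qed
  define Z where "Z = {q \<in> Q. \<not> exponential (y q) \<and> (\<exists>t. y q t > 0)}"
  have ZQ: "Z \<subseteq> Q" and finZ: "finite Z" using finite_Q by (auto simp: Z_def)
  \<comment> \<open>A successor outside \<open>Z\<close> is identically zero or exponential; in the
    latter case its weight is 0, as otherwise \<open>q\<close> would be exponential.\<close>
  have Z_Suc: "y q (Suc m) = (\<Sum>p\<in>Z. B q p * y p m)" if "q \<in> Z" for q m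
  proof -
    have "B q p * y p m = 0" if "p \<in> Q - Z" for p
      using exp_step[of q p] that \<open>q \<in> Z\<close> by (auto simp: Z_def)
    then show ?thesis
      using y_Suc[of q m] that ZQ finite_Q by (subst sum.mono_neutral_left[OF finite_Q ZQ]) auto
  qed
  have Z_diag: "(\<forall>k. matpow k q q \<le> 1) \<and> (B q q = 1 \<or> (\<forall>k>0. matpow k q q = 0))" if "q \<in> Z" for q
    using P[of q] exp_loop[of q] that unfolding B_def Z_def by blast
  \<comment> \<open>An edge from \<open>q\<close> to \<open>p\<close> is stored as
    \<open>(p, q)\<close>, so that well-founded induction treats the successors of \<open>q\<close>
    first.\<close>
  define R where "R = {(p, q). p \<in> Z \<and> q \<in> Z \<and> p \<noteq> q \<and> B q p > 0}"
  have R_trancl: "\<exists>k>0. matpow (P * k) q p > 0" if "(p, q) \<in> R\<^sup>+" for p q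
    using that
  proof induction
    case (base q)
    then show ?case by (intro exI[of _ 1]) (auto simp: R_def B_def)
  next
    case (step s q)
    then obtain k where k: "matpow (P * k) s p > 0" by blast
    have "q \<in> Q" "s \<in> Q" "B q s > 0" using step.hyps ZQ by (auto simp: R_def)
    then have "0 < matpow P q s * matpow (P * k) s p" using k by (simp add: B_def)
    also have "\<dots> \<le> matpow (P + P * k) q p" by (rule matpow_add_ge) fact+
    finally have "matpow (P + P * k) q p > 0" .
    then show ?case by (intro exI[of _ "Suc k"]) simp
  qed
  txt \<open>A cycle through \<open>q\<close> together with the loop at \<open>q\<close> would give two walks of equal length.\<close>
  have "acyclic R"
  proof (rule acyclicI, intro allI notI)
    fix q assume "(q, q) \<in> R\<^sup>+"
    then obtain p where qp: "(q, p) \<in> R\<^sup>*" "(p, q) \<in> R" using tranclD2 by metis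
    moreover from this have "p \<noteq> q" by (simp add: R_def)
    ultimately have p: "(q, p) \<in> R\<^sup>+" "(p, q) \<in> R" by (auto simp: rtrancl_eq_or_trancl)
    obtain k where k: "k > 0" "matpow (P * k) p q > 0" using R_trancl[OF p(1)] by blast
    have pq: "p \<in> Q" "q \<in> Q" "q \<in> Z" "p \<noteq> q" "B q p > 0" using p(2) ZQ by (auto simp: R_def)
    have "0 < matpow P q p * matpow (P * k) p q" using k pq(5) by (simp add: B_def)
    also have "\<dots> \<le> matpow (P + P * k) q q"
      by (rule matpow_add_ge[OF pq(2,1)])
    finally have pos: "matpow (P + P * k) q q \<noteq> 0" by simp
    \<comment> \<open>The closed walk just found rules out the last case of \<open>Z_diag\<close>,
      which leaves a loop of weight one.\<close>
    have "\<not> (\<forall>k>0. matpow k q q = 0)"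
    proof
      assume "\<forall>k>0. matpow k q q = 0"
      from this[rule_format, of "P + P * k"] pos \<open>P > 0\<close> show False by simp
    qed
    then have Bqq: "B q q = 1" using Z_diag[OF pq(3)] by (elim conjE disjE) auto
    have "matpow P q q \<le> matpow (P * Suc (k - 1)) q q"
      by (rule matpow_diag_mono) (use pq Bqq in \<open>auto simp: B_def\<close>)
    then have loop: "matpow (P * k) q q \<ge> 1" using Bqq k by (simp add: B_def)
    have "1 * 1 + 1 * 1 \<le> B q q * matpow (P * k) q q + B q p * matpow (P * k) p q"
      by (intro add_le_mono mult_le_mono) (use Bqq loop pq k in auto)
    also have "\<dots> = (\<Sum>s\<in>{q, p}. B q s * matpow (P * k) s q)" using pq(4) by simp
    also have "\<dots> \<le> matpow (P + P * k) q q"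
      unfolding matpow_add[OF pq(2)] B_def by (rule sum_mono2) (use pq finite_Q in auto)
    finally have "2 \<le> matpow (P + P * k) q q" by simp
    moreover have "matpow (P + P * k) q q \<le> 1" using Z_diag[OF pq(3)] by blast
    ultimately show False by linarith
  qed
  moreover have "finite R"
    by (rule finite_subset[of _ "Z \<times> Z"]) (use finZ in \<open>auto simp: R_def\<close>)
  ultimately have "wf R" by (intro finite_acyclic_wf)
  have Z_fcp: "q \<in> Z \<Longrightarrow> functional_closure_property (y q)" for q
    using \<open>wf R\<close>
  proof (induction q rule: wf_induct_rule)
    case (less q)
    define z where "z m = (\<Sum>p\<in>Z - {q}. B q p * y p m)" for m
    have z: "functional_closure_property z"
      unfolding z_def
    proof (rule fcp_sum)
      fix p assume p: "p \<in> Z - {q}"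
      show "functional_closure_property (\<lambda>m. B q p * y p m)"
      proof (cases "B q p = 0")
        case False
        then have "functional_closure_property (y p)"
          using p less by (auto simp: R_def)
        then show ?thesis by (intro fcp_mult fcp_const)
      qed (simp add: fcp_const)
    qed
    have step: "y q (Suc m) = B q q * y q m + z m" for m
      unfolding Z_Suc[OF less.prems] z_def using finZ less.prems by (rule sum.remove)
    have "B q q \<le> 1" using Z_diag[OF less.prems] by (simp add: B_def)
    then consider "B q q = 0" | "B q q = 1" by linarith
    then show ?case
    proof cases
      case 1
      \<comment> \<open>The value at 0 is supplied separately, because \<open>m - 1\<close> is
        truncated there.\<close>
      have "y q = (\<lambda>m. of_bool (m \<in> {0}) * y q m + of_bool (m \<notin> {0}) * z (m - 1))"
      proof
        fix m show "y q m = of_bool (m \<in> {0}) * y q m + of_bool (m \<notin> {0}) * z (m - 1)"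
          using step 1 by (cases m) auto
      qed
      moreover have "functional_closure_property \<dots>"
        by (intro fcp_add fcp_finite_support fcp_mult fcp_comp[OF z] fcp_diff_1) auto
      ultimately show ?thesis by simp
    next
      case 2
      have "y q m = y q 0 + (\<Sum>i<m. z i)" for m
        by (induction m) (auto simp: step 2)
      then have "y q = (\<lambda>m. y q 0 + (\<Sum>i<m. z i))" ..
      moreover have "functional_closure_property \<dots>"
        by (intro fcp_add fcp_const fcp_sum_lessThan z)
      ultimately show ?thesis by simp
    qed
  qed
  have "exponential (y q) \<or> functional_closure_property (y q)"
  proof (cases "\<exists>t. y q t > 0")
    case True
    then show ?thesis using Z_fcp \<open>q \<in> Q\<close> by (auto simp: Z_def)
  next
    case False
    then have "y q = (\<lambda>_. 0)" by auto
    then show ?thesis using fcp_const[of 0] by simp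
  qed
  then show ?thesis by (simp add: y_def[abs_def])
qed

end

end

text \<open>Over one letter a word is its length, and the letter relations become a linear
  recurrence with a fixed matrix; the period depends on the matrix only and so serves all
  \<open>r\<close>.\<close>

lemma unary_exponential_or_fcp:
  assumes "g \<in> sharpFA {a}"
  shows "\<exists>P>0. \<forall>r. exponential (\<lambda>m. g (replicate (r + P * m) a)) \<or>
    functional_closure_property (\<lambda>m. g (replicate (r + P * m) a))"
proof -
  obtain Q :: "nat option set" and X q0 where X: "stable_family {a} Q X" "q0 \<in> Q" "X q0 = g"
    by (rule sharpFA_stable[OF assms])
  obtain c where c: "\<forall>q\<in>Q. \<forall>b\<in>{a}. \<forall>w\<in>lists {a}. X q (b # w) = (\<Sum>p\<in>Q. c q b p * X p w)"
    using stable_coeffs[OF X(1)] by blast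
  have fin: "finite Q" using stableD[OF X(1)] by blast
  define A where "A q p = c q a p" for q p
  define x where "x q n = X q (replicate n a)" for q n
  have x: "x q (Suc n) = (\<Sum>p\<in>Q. A q p * x p n)" if "q \<in> Q" for q n
    using c that by (simp add: x_def A_def in_lists_conv_set)
  obtain P where P: "P > 0" "\<forall>q\<in>Q. matpow Q A P q q \<ge> 2 \<or>
     (\<forall>k. matpow Q A k q q \<le> 1) \<and> (matpow Q A P q q = 1 \<or> (\<forall>k>0. matpow Q A k q q = 0))"
    using good_period[OF fin, of A] by blast
  have "exponential (\<lambda>m. x q0 (r + P * m)) \<or> functional_closure_property (\<lambda>m. x q0 (r + P * m))" for r
    by (rule exponential_or_fcp[OF fin, where A = A]) (use x P X(2) in auto)
  then show ?thesis using P(1) X(3) unfolding x_def by blast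
qed

section \<open>Growth on the promise\<close>

text \<open>Each letter multiplies a common bound for the members by at most a coefficient sum,
  hence by at most \<open>2 ^ K\<close>.\<close>

lemma sharpFA_growth:
  assumes "f \<in> sharpFA \<Sigma>"
  shows "\<exists>C K. \<forall>w\<in>lists \<Sigma>. f w \<le> 2 ^ (C + K * length w)"
proof -
  obtain Q :: "nat option set" and X q0 where X: "stable_family \<Sigma> Q X" "q0 \<in> Q" "X q0 = f"
    by (rule sharpFA_stable[OF assms])
  note fin = stableD(1,2)[OF X(1)]
  obtain c where c: "\<forall>q\<in>Q. \<forall>a\<in>\<Sigma>. \<forall>w\<in>lists \<Sigma>. X q (a # w) = (\<Sum>p\<in>Q. c q a p * X p w)"
    using stable_coeffs[OF X(1)] by blast
  define C where "C = (\<Sum>q\<in>Q. X q [])"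
  define K where "K = (\<Sum>(q, a)\<in>Q \<times> \<Sigma>. \<Sum>p\<in>Q. c q a p)"
  have K: "(\<Sum>p\<in>Q. c q a p) \<le> 2 ^ K" if "q \<in> Q" "a \<in> \<Sigma>" for q a
  proof -
    have "(\<Sum>p\<in>Q. c q a p) \<le> K"
      unfolding K_def using member_le_sum[of "(q, a)" "Q \<times> \<Sigma>" "\<lambda>(q, a). \<Sum>p\<in>Q. c q a p"] fin that
      by simp
    also have "K \<le> 2 ^ K" by (rule less_imp_le[OF less_exp])
    finally show ?thesis .
  qed
  have "X q w \<le> 2 ^ (C + K * length w)" if "w \<in> lists \<Sigma>" "q \<in> Q" for w q
    using that
  proof (induction w arbitrary: q)
    case Nil
    have "X q [] \<le> C" unfolding C_def by (rule member_le_sum) (use Nil fin in auto)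
    also have "C \<le> 2 ^ C" by (rule less_imp_le[OF less_exp])
    finally show ?case by simp
  next
    case (Cons a w)
    have "X q (a # w) = (\<Sum>p\<in>Q. c q a p * X p w)" using c Cons by blast
    also have "\<dots> \<le> (\<Sum>p\<in>Q. c q a p * 2 ^ (C + K * length w))"
      by (intro sum_mono mult_le_mono order_refl Cons.IH)
    also have "\<dots> \<le> 2 ^ K * 2 ^ (C + K * length w)"
      unfolding sum_distrib_right[symmetric] using K Cons by (intro mult_le_mono) auto
    finally show ?case by (simp add: power_add ac_simps)
  qed
  then show ?thesis using X by blast
qed

section \<open>Binary values and unary lengths\<close>

primrec lsb_value :: "nat list \<Rightarrow> nat" where
  "lsb_value [] = 0"
| "lsb_value (a # w) = a + 2 * lsb_value w"

text \<open>With the least significant digit first, prepending a digit is an affine map, so adding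
  the constant 1 gives a stable family.\<close>

lemma lsb_value_sharpFA: "lsb_value \<in> sharpFA {0, 1}"
proof -
  let ?X = "\<lambda>b w. if b then lsb_value w else 1"
  have "stable_family {0, 1} (UNIV :: bool set) ?X"
  proof (rule stableI)
    fix b :: bool and a :: nat
    show "spanned {0, 1} UNIV ?X (\<lambda>w. ?X b (a # w))"
      by (rule spannedI[where c = "\<lambda>b'. if b then (if b' then 2 else a) else of_bool (\<not> b')"])
        (simp add: UNIV_bool)
  qed auto
  from sharpFA_member[OF this, of True] show ?thesis by simp
qed

text \<open>Halving removes one digit. The short word matters: it turns an exponential bound in the
  length into a polynomial bound in \<open>n\<close>.\<close>

lemma lsb_value_surj:
  "n > 0 \<Longrightarrow> \<exists>w\<in>lists {0, 1}. lsb_value w = n \<and> 2 ^ length w \<le> 2 * n"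
proof (induction n rule: less_induct)
  case (less n)
  show ?case
  proof (cases "n = 1")
    case True
    then show ?thesis by (intro bexI[of _ "[1]"]) auto
  next
    case False
    then have "n div 2 > 0" "n div 2 < n" using less.prems by auto
    then obtain w where w: "w \<in> lists {0, 1}" "lsb_value w = n div 2" "2 ^ length w \<le> 2 * (n div 2)"
      using less.IH by blast
    have "n mod 2 = 0 \<or> n mod 2 = 1" by auto
    then show ?thesis using w by (intro bexI[of _ "(n mod 2) # w"]) auto
  qed
qed

lemma length_sharpFA: "length \<in> sharpFA {a}"
proof -
  let ?X = "\<lambda>b w. if b then length w else 1"
  have "stable_family {a} (UNIV :: bool set) ?X"
  proof (rule stableI)
    fix b :: bool and a' :: 'a
    show "spanned {a} UNIV ?X (\<lambda>w. ?X b (a' # w))"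
      by (rule spannedI[where c = "\<lambda>b'. if b then 1 else of_bool (\<not> b')"]) (simp add: UNIV_bool)
  qed auto
  from sharpFA_member[OF this, of True] show ?thesis by simp
qed

section \<open>Exponential against polynomial growth\<close>

lemma affine_less_power: "\<exists>l0. \<forall>l\<ge>l0. \<alpha> + \<beta> * l < (2::nat) ^ l"
proof -
  define s where "s = \<alpha> + 2 * \<beta>"
  \<comment> \<open>The bound on \<beta> is carried along so that doubling absorbs the \<beta> added
    in the induction step. At \<open>l = 2 * s\<close> the left side is at most
    \<open>s + s * s\<close>, the right side at least \<open>Suc s * Suc s\<close>.\<close>
  have "\<alpha> + \<beta> * l < 2 ^ l \<and> \<beta> \<le> 2 ^ l" if "l \<ge> 2 * s" for l
    using that
  proof (induction l rule: dec_induct)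
    case base
    have s: "Suc s \<le> 2 ^ s" by (simp add: Suc_leI)
    have "Suc s * Suc s \<le> 2 ^ s * 2 ^ s" by (intro mult_le_mono s)
    then have "Suc s * Suc s \<le> 2 ^ (2 * s)" by (simp add: mult_2 power_add)
    moreover have "2 * \<beta> * s \<le> s * s" by (intro mult_le_mono) (auto simp: s_def)
    moreover have "Suc s * Suc s = s * s + 2 * s + 1" by simp
    moreover have "\<alpha> \<le> s" "\<beta> \<le> s" by (auto simp: s_def)
    moreover have "\<beta> * (2 * s) = 2 * \<beta> * s" by simp
    ultimately show ?case by linarith
  qed auto
  then show ?thesis by blast
qed

text \<open>For \<open>n = r + P * m\<close> in \<open>S\<close>, with \<open>n > 0\<close> and
  \<open>m\<close> at least \<open>t\<close>, take a short binary word \<open>w\<close> of value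
  \<open>n\<close>. Comparing \<open>2 ^ (m - t)\<close> with the growth bound for
  \<open>g w\<close> makes \<open>m\<close>, hence \<open>n\<close>, at most affine in
  \<open>length w\<close>; but \<open>2 ^ length w\<close> is at most \<open>2 * n\<close>, so
  \<open>length w\<close> is bounded.\<close>

lemma finite_promise_if_exponential:
  assumes "functional_promise_closure_property S \<phi>"
    and exp: "exponential (\<lambda>m. G (r + P * m))" and G: "\<And>n. n \<in> S \<Longrightarrow> G n = \<phi> n"
  shows "finite {n \<in> S. \<exists>m. n = r + P * m}"
proof -
  obtain g where g: "g \<in> sharpFA {0, 1 :: nat}" "\<And>w. w \<in> lists {0, 1} \<Longrightarrow> lsb_value w \<in> S \<Longrightarrow> g w = \<phi> (lsb_value w)"
    using assms(1) lsb_value_sharpFA unfolding functional_promise_closure_property_def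
    by (meson finite.emptyI finite.insertI)
  obtain C K where CK: "\<And>w. w \<in> lists {0, 1} \<Longrightarrow> g w \<le> 2 ^ (C + K * length w)"
    using sharpFA_growth[OF g(1)] by blast
  obtain t where t: "\<And>m. 2 ^ m \<le> G (r + P * (m + t))" using exp unfolding exponential_def by blast
  obtain l0 where l0: "\<And>l. l \<ge> l0 \<Longrightarrow> 2 * (r + P * (t + C)) + 2 * P * K * l < 2 ^ l"
    using affine_less_power by blast
  define b where "b = r + P * (t + C + K * l0)"
  have "n \<le> b" if n: "n \<in> S" "n = r + P * m" for n m
  \<comment> \<open>\<open>lsb_value_surj\<close> needs \<open>n > 0\<close>, and the lower bound
    needs \<open>m\<close> to be at least \<open>t\<close>; otherwise \<open>n\<close> is at most
    \<open>b\<close> directly.\<close>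
  proof (cases "n = 0 \<or> m < t")
    case True
    then show ?thesis
      unfolding b_def using n(2) by (auto intro!: mult_le_mono)
  next
    case False
    then obtain w where w: "w \<in> lists {0, 1}" "lsb_value w = n" "2 ^ length w \<le> 2 * n"
      using lsb_value_surj by blast
    have "2 ^ (m - t) \<le> G n" using t[of "m - t"] False n(2) by simp
    also have "\<dots> = g w" using G g(2) w n(1) by simp
    also have "\<dots> \<le> 2 ^ (C + K * length w)" by (rule CK[OF w(1)])
    finally have "m - t \<le> C + K * length w" by simp
    then have m: "m \<le> t + C + K * length w" by linarith
    have n_le: "n \<le> r + P * (t + C + K * length w)" unfolding n(2) using m by simp
    have "2 * (r + P * (t + C + K * length w)) = 2 * (r + P * (t + C)) + 2 * P * K * length w"
      by (simp add: algebra_simps)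
    moreover have "2 ^ length w \<le> 2 * (r + P * (t + C + K * length w))"
      using w(3) mult_le_mono2[OF n_le] by (rule order_trans)
    ultimately have "\<not> 2 * (r + P * (t + C)) + 2 * P * K * length w < 2 ^ length w"
      by (simp only: not_less)
    then have "length w \<le> l0" using l0 by (meson nat_le_linear)
    then have "r + P * (t + C + K * length w) \<le> b" unfolding b_def by simp
    with n_le show ?thesis by linarith
  qed
  then have "{n \<in> S. \<exists>m. n = r + P * m} \<subseteq> {..b}" by auto
  then show ?thesis by (rule finite_subset) simp
qed

theorem theorem33:
  fixes S :: "nat set" and \<phi> :: "nat \<Rightarrow> nat"
  shows "functional_promise_closure_property S \<phi> \<longleftrightarrow>
    (\<exists>\<psi> :: nat \<Rightarrow> nat. functional_closure_property \<psi> \<and> (\<forall>n\<in>S. \<phi> n = \<psi> n))"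
proof
  assume promise: "functional_promise_closure_property S \<phi>"
  \<comment> \<open>The promise for \<open>length\<close> over one letter reaches all of
    \<open>S\<close>, since every number is a length.\<close>
  obtain g where g: "g \<in> sharpFA {0 :: nat}" "\<And>w. w \<in> lists {0} \<Longrightarrow> length w \<in> S \<Longrightarrow> g w = \<phi> (length w)"
    using promise length_sharpFA unfolding functional_promise_closure_property_def
    by (meson finite.emptyI finite.insertI)
  define G where "G n = g (replicate n 0)" for n
  have G: "G n = \<phi> n" if "n \<in> S" for n
    using g(2)[of "replicate n 0"] that by (auto simp: G_def in_lists_conv_set)
  obtain P where P: "P > 0"
    "\<And>r. exponential (\<lambda>m. G (r + P * m)) \<or> functional_closure_property (\<lambda>m. G (r + P * m))"
    using unary_exponential_or_fcp[OF g(1)] unfolding G_def by blast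
  \<comment> \<open>On residues below \<open>P\<close> outside \<open>T\<close> the sequence is
    exponential, so the part \<open>D\<close> of \<open>S\<close> lying there is finite.\<close>
  define T where "T = {r. r < P \<and> functional_closure_property (\<lambda>m. G (r + P * m))}"
  define D where "D = {n \<in> S. n mod P \<notin> T}"
  have "D \<subseteq> (\<Union>r\<in>{..<P} - T. {n \<in> S. \<exists>m. n = r + P * m})"
  proof
    fix n assume "n \<in> D"
    then have "n \<in> S" "n mod P \<in> {..<P} - T" using P(1) by (auto simp: D_def)
    moreover have "\<exists>m. n = n mod P + P * m" by (rule exI[of _ "n div P"]) simp
    ultimately show "n \<in> (\<Union>r\<in>{..<P} - T. {n \<in> S. \<exists>m. n = r + P * m})" by blast
  qed
  moreover have "finite {n \<in> S. \<exists>m. n = r + P * m}" if "r \<in> {..<P} - T" for r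
    using finite_promise_if_exponential[OF promise _ G] P(2)[of r] that unfolding T_def by blast
  ultimately have finD: "finite D" by (auto intro: finite_subset)
  \<comment> \<open>The values on \<open>D\<close> are tabulated; off \<open>D\<close> the sum
    selects the class of \<open>n\<close>, where \<open>r + P * (n div P)\<close> gives back
    \<open>n\<close>.\<close>
  define \<psi> where "\<psi> n = of_bool (n \<in> D) * \<phi> n +
    of_bool (n \<notin> D) * (\<Sum>r\<in>T. of_bool (n mod P = r) * G (r + P * (n div P)))" for n
  have "functional_closure_property \<psi>"
    unfolding \<psi>_def
  proof (rule fcp_add[OF fcp_finite_support(1)[OF finD] fcp_mult[OF fcp_finite_support(2)[OF finD]]],
      intro fcp_sum fcp_mult fcp_of_bool_mod P(1))
    fix r assume "r \<in> T"
    then show "functional_closure_property (\<lambda>n. G (r + P * (n div P)))"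
      using fcp_comp[OF _ fcp_div[OF P(1)], where \<psi> = "\<lambda>m. G (r + P * m)"] by (simp add: T_def)
  qed
  moreover have "\<phi> n = \<psi> n" if "n \<in> S" for n
  proof (cases "n \<in> D")
    case False
    then have "n mod P \<in> T" using that by (simp add: D_def)
    moreover have "finite T" by (simp add: T_def)
    ultimately have "(\<Sum>r\<in>T. of_bool (n mod P = r) * G (r + P * (n div P))) = G n"
      by (simp add: of_bool_def if_distrib[of "\<lambda>x. x * _"] cong: if_cong)
    then show ?thesis using False G[OF that] by (simp add: \<psi>_def)
  qed (simp add: \<psi>_def)
  ultimately show "\<exists>\<psi>. functional_closure_property \<psi> \<and> (\<forall>n\<in>S. \<phi> n = \<psi> n)" by blast
next
  assume "\<exists>\<psi>. functional_closure_property \<psi> \<and> (\<forall>n\<in>S. \<phi> n = \<psi> n)"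
  then obtain \<psi> where \<psi>: "functional_closure_property \<psi>" "\<And>n. n \<in> S \<Longrightarrow> \<phi> n = \<psi> n" by blast
  show "functional_promise_closure_property S \<phi>"
    unfolding functional_promise_closure_property_def
  proof (intro allI impI ballI)
    fix \<Sigma> :: "nat set" and f assume "f \<in> sharpFA \<Sigma>"
    from functional_closure_propertyD[OF \<psi>(1) this]
    show "\<exists>g\<in>sharpFA \<Sigma>. \<forall>w\<in>lists \<Sigma>. f w \<in> S \<longrightarrow> g w = \<phi> (f w)"
      by (rule bexI[rotated]) (simp add: \<psi>(2))
  qed
qed

end
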